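(* Let $n\ge 1$ and let $\sigma=\{(G_j,p_j)\}_{j\ge 1}$ be a sequence of pointed domains in $\mathbb{C}^n$ tamed at $\hat p\in\mathbb{C}^n$. Then there exists a subsequence $\tau$ of $\sigma$ which converges, in the sense of Carathéodory, to its kernel $\mathbf{Ker}_{\hat p}(\tau)$.
   Context: A pointed set is a pair $(G,p)$ consisting of a set $G$ and a point $p\in G$; it is a pointed domain if $G$ is a connected open set. Two pointed sets are equal if the sets and the points agree. A sequence $\{(G_j,p_j)\}_{j\ge1}$ of pointed domains in $\mathbb{C}^n$ is tamed at $\hat p\in\mathbb{C}^n$ if (1) $\lim_{j\to\infty}p_j=\hat p$, and (2) there is an open neighborhood of $\hat p$ contained in $\bigcap_{j\ge k}G_j$ for some $k\ge1$. (Every subsequence of a tamed sequence is then tamed at $\hat p$.) $A^\circ$ denotes the interior of $A$, and $\operatorname{Conn}_q(A)$ denotes the connected component of $A$ containing $q$ (empty if $q\notin A$). The Carathéodory kernel of a sequence of pointed domains tamed at $\hat p$ is the pointed set $$\mathbf{Ker}_{\hat p}\{(G_j,p_j)\}_{j\ge1}:=\Big(\bigcup_{k\ge1}\operatorname{Conn}_{\hat p}\Big(\big(\bigcap_{j\ge k}G_j\big)^\circ\Big),\ \hat p\Big).$$ A sequence $\{(G_j,p_j)\}_{j\ge1}$ of pointed domains tamed at $\hat p$ converges (to its kernel, in the sense of Carathéodory) if for each subsequence $\{(G_{j_k},p_{j_k})\}_{k\ge1}$ the kernel is the same, i.e. $\mathbf{Ker}_{\hat p}\{(G_j,p_j)\}_{j\ge1}=\mathbf{Ker}_{\hat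 p}\{(G_{j_k},p_{j_k})\}_{k\ge1}$. *)

theory Defs
  imports "HOL-Analysis.Analysis"
begin

(* Sequences are indexed from 0 instead of from 1; a subsequence of s is s \<circ> r
   for a strictly increasing r. *)

type_synonym 'a pointed = "'a set \<times> 'a"

definition pointed_domain :: "'a::topological_space pointed \<Rightarrow> bool" where
  "pointed_domain P \<longleftrightarrow> snd P \<in> fst P \<and> open (fst P) \<and> connected (fst P)"

definition tamed_at :: "'a::topological_space \<Rightarrow> (nat \<Rightarrow> 'a pointed) \<Rightarrow> bool" where
  "tamed_at q s \<longleftrightarrow>
     (\<forall>j. pointed_domain (s j)) \<and>
     (\<lambda>j. snd (s j)) \<longlonglongrightarrow> q \<and>
     (\<exists>k U. open U \<and> q \<in> U \<and> U \<subseteq> (\<Inter>j\<in>{k..}. fst (s j)))"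

(* connected_component_set A q is empty if q is not in A, as required of Conn_q(A). *)

definition caratheodory_kernel ::
    "'a::topological_space \<Rightarrow> (nat \<Rightarrow> 'a pointed) \<Rightarrow> 'a pointed" where
  "caratheodory_kernel q s =
     (\<Union>k. connected_component_set (interior (\<Inter>j\<in>{k..}. fst (s j))) q, q)"

(* Convergence is only meaningful for tamed sequences, so tameness is part of it. *)

definition caratheodory_converges ::
    "'a::topological_space \<Rightarrow> (nat \<Rightarrow> 'a pointed) \<Rightarrow> bool" where
  "caratheodory_converges q s \<longleftrightarrow>
     tamed_at q s \<and>
     (\<forall>r :: nat \<Rightarrow> nat. strict_mono r \<longrightarrow>
        caratheodory_kernel q s = caratheodory_kernel q (s \<circ> r))"

end

theory Submission
  imports Defs "HOL-Library.Diagonal_Subsequence"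
begin

text \<open>
  The kernel is the component of \<open>q\<close> in the increasing union of the open sets
  \<open>interior (\<Inter>j\<ge>k. G\<^sub>j)\<close>, and a point lies in that union iff it has a basic open
  neighbourhood contained in almost all \<open>G\<^sub>j\<close>. A diagonal argument over a countable basis
  yields a subsequence along which every basic open set is either contained in almost all of the
  domains or in almost none; both alternatives are inherited by subsequences.
\<close>

text \<open>Pigeonhole: one of the two index sets is infinite, and enumerating it gives
  \<open>r\<close>. This is the single refinement step of the diagonal argument.\<close>

lemma subseq_all_or_none:
  fixes s :: "nat \<Rightarrow> nat"
  shows "\<exists>r :: nat \<Rightarrow> nat. strict_mono r \<and> ((\<forall>j. Q (s (r j))) \<or> (\<forall>j. \<not> Q (s (r j))))"
proof (cases "infinite {j. Q (s j)}")
  case True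
  then show ?thesis using infinite_enumerate[OF True] by auto
next
  case False
  then have "infinite {j. \<not> Q (s j)}"
    by (simp add: finite_Collect_not)
  then show ?thesis using infinite_enumerate[of "{j. \<not> Q (s j)}"] by auto
qed

lemma diagonal_subseq_eventually:
  fixes Q :: "nat \<Rightarrow> nat \<Rightarrow> bool"
  obtains r :: "nat \<Rightarrow> nat" where "strict_mono r"
    "\<And>n. (\<forall>\<^sub>F j in sequentially. Q n (r j)) \<or> (\<forall>\<^sub>F j in sequentially. \<not> Q n (r j))"
proof -
  let ?P = "\<lambda>n s. (\<forall>j. Q n (s j)) \<or> (\<forall>j. \<not> Q n (s j))"
  interpret subseqs ?P
    by standard (simp only: comp_apply subseq_all_or_none)
  have "(\<forall>\<^sub>F j in sequentially. Q n (diagseq j)) \<or>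
      (\<forall>\<^sub>F j in sequentially. \<not> Q n (diagseq j))" for n
  proof -
    \<comment> \<open>Only from index \<open>Suc n\<close> on is the diagonal sequence a subsequence
      of the one refined for \<open>Q n\<close>. The all-or-none property passes to it there, so
      just an eventual statement survives.\<close>
    have "?P n (diagseq \<circ> (+) (Suc n))"
      by (rule diagseq_holds) auto
    then have "(\<forall>j. Q n (diagseq (j + Suc n))) \<or> (\<forall>j. \<not> Q n (diagseq (j + Suc n)))"
      by (simp only: comp_apply add.commute)
    then have "(\<forall>\<^sub>F j in sequentially. Q n (diagseq (j + Suc n))) \<or>
        (\<forall>\<^sub>F j in sequentially. \<not> Q n (diagseq (j + Suc n)))"
      using always_eventually by (elim disjE) simp_all
    then show ?thesis
      using eventually_sequentially_seg[of "\<lambda>j. Q n (diagseq j)" "Suc n"]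
        eventually_sequentially_seg[of "\<lambda>j. \<not> Q n (diagseq j)" "Suc n"] by argo
  qed
  then show thesis
    using that subseq_diagseq by blast
qed

text \<open>In open subsets of a normed space, components are path components. A path in the union
  has compact image, so finitely many of the increasing open sets cover it, and hence one
  does.\<close>

lemma connected_component_set_UN_mono:
  fixes V :: "nat \<Rightarrow> 'a::real_normed_vector set"
  assumes "mono V" and op: "\<And>k. open (V k)"
  shows "(\<Union>k. connected_component_set (V k) q) = connected_component_set (\<Union>k. V k) q"
proof
  show "(\<Union>k. connected_component_set (V k) q) \<subseteq> connected_component_set (\<Union>k. V k) q"
    by (intro UN_least connected_component_mono) blast
  show "connected_component_set (\<Union>k. V k) q \<subseteq> (\<Union>k. connected_component_set (V k) q)"
  proof
    fix x assume "x \<in> connected_component_set (\<Union>k. V k) q"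
    then have "path_component (\<Union>k. V k) q x"
      using open_path_connected_component[of "\<Union>k. V k"] op by (simp add: open_UN)
    then obtain g where g: "path g" "path_image g \<subseteq> (\<Union>k. V k)" "pathstart g = q" "pathfinish g = x"
      unfolding path_component_def by blast
    obtain K where K: "finite K" "path_image g \<subseteq> (\<Union>k\<in>K. V k)"
      by (rule compactE_image[OF compact_path_image[OF g(1)] op g(2)])
    \<comment> \<open>No case split on \<open>K\<close> is needed: for empty \<open>K\<close> the
      left side is empty, whatever \<open>Max K\<close> is.\<close>
    have "(\<Union>k\<in>K. V k) \<subseteq> V (Max K)"
      by (intro UN_least monoD[OF assms(1)] Max_ge K(1))
    with K(2) have "path_image g \<subseteq> V (Max K)"
      by (rule subset_trans)
    with g have "path_component (V (Max K)) q x"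
      unfolding path_component_def by blast
    then have "connected_component (V (Max K)) q x"
      by (simp only: open_path_connected_component[OF op])
    then show "x \<in> (\<Union>k. connected_component_set (V k) q)"
      by blast
  qed
qed

text \<open>Taking the component after the union makes the kernel depend on the sequence only
  through a union of interiors, so comparing kernels reduces to comparing these unions.\<close>

lemma caratheodory_kernel_eq:
  fixes q :: "'a::real_normed_vector"
  shows "caratheodory_kernel q s =
    (connected_component_set (\<Union>k. interior (\<Inter>j\<in>{k..}. fst (s j))) q, q)"
proof -
  have "mono (\<lambda>k. interior (\<Inter>j\<in>{k..}. fst (s j)))"
    by (intro monoI interior_mono INT_anti_mono) auto
  then show ?thesis
    unfolding caratheodory_kernel_def by (subst connected_component_set_UN_mono) auto
qed

text \<open>Reduces the union of interiors to countably many eventual conditions, one for each basic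
  set, which is the form a diagonal argument can control.\<close>

lemma mem_UN_interior_INT_iff:
  fixes G :: "nat \<Rightarrow> 'a::topological_space set"
  assumes "topological_basis (range B)"
  shows "x \<in> (\<Union>k. interior (\<Inter>j\<in>{k..}. G j)) \<longleftrightarrow>
    (\<exists>n. x \<in> B n \<and> (\<forall>\<^sub>F j in sequentially. B n \<subseteq> G j))"
proof
  assume "x \<in> (\<Union>k. interior (\<Inter>j\<in>{k..}. G j))"
  then obtain k where "x \<in> interior (\<Inter>j\<in>{k..}. G j)" by blast
  then obtain n where n: "x \<in> B n" "B n \<subseteq> interior (\<Inter>j\<in>{k..}. G j)"
    using topological_basisE[OF assms open_interior] by (metis rangeE)
  then have "\<forall>j\<ge>k. B n \<subseteq> G j"
    using interior_subset[of "\<Inter>j\<in>{k..}. G j"] by (meson INT_lower atLeast_iff subset_trans)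
  then show "\<exists>n. x \<in> B n \<and> (\<forall>\<^sub>F j in sequentially. B n \<subseteq> G j)"
    using n(1) unfolding eventually_sequentially by blast
next
  assume "\<exists>n. x \<in> B n \<and> (\<forall>\<^sub>F j in sequentially. B n \<subseteq> G j)"
  then obtain n k where n: "x \<in> B n" "\<forall>j\<ge>k. B n \<subseteq> G j"
    unfolding eventually_sequentially by blast
  have "open (B n)"
    using topological_basis_open[OF assms] by blast
  then have "B n \<subseteq> interior (\<Inter>j\<in>{k..}. G j)"
    using n(2) by (intro interior_maximal INT_greatest) auto
  then show "x \<in> (\<Union>k. interior (\<Inter>j\<in>{k..}. G j))"
    using n(1) by blast
qed

lemma tamed_at_subseq:
  assumes "tamed_at q s" and r: "strict_mono r"
  shows "tamed_at q (s \<circ> r)"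
proof -
  obtain k U where U: "open U" "q \<in> U" "U \<subseteq> (\<Inter>j\<in>{k..}. fst (s j))"
    using assms(1) unfolding tamed_at_def by blast
  \<comment> \<open>The same \<open>k\<close> works because \<open>j \<le> r j\<close>.\<close>
  have "U \<subseteq> (\<Inter>j\<in>{k..}. fst ((s \<circ> r) j))"
    using U(3) seq_suble[OF r] by (fastforce intro: order_trans)
  moreover have "(\<lambda>j. snd ((s \<circ> r) j)) \<longlonglongrightarrow> q"
    using assms LIMSEQ_subseq_LIMSEQ[of "\<lambda>j. snd (s j)" q r] unfolding tamed_at_def comp_def by blast
  ultimately show ?thesis
    using U(1,2) assms(1) unfolding tamed_at_def by (metis comp_apply)
qed

lemma caratheodory_converges_subseq:
  fixes q :: "'a::{real_normed_vector,second_countable_topology}"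
  assumes "tamed_at q s"
  obtains r :: "nat \<Rightarrow> nat" where "strict_mono r" "caratheodory_converges q (s \<circ> r)"
proof -
  obtain \<B> :: "'a set set" where \<B>: "countable \<B>" "topological_basis \<B>"
    using ex_countable_basis by blast
  \<comment> \<open>A nonempty countable set is the range of \<open>from_nat_into\<close>, possibly
    with repetitions.\<close>
  then have "\<B> \<noteq> {}"
    using topological_basisE[OF \<B>(2) open_UNIV] by blast
  then have B: "topological_basis (range (from_nat_into \<B>))" (is "topological_basis (range ?B)")
    using \<B> by (simp add: range_from_nat_into)
  obtain r where r: "strict_mono r" and dich:
    "\<And>n. (\<forall>\<^sub>F j in sequentially. ?B n \<subseteq> fst (s (r j))) \<or>
      (\<forall>\<^sub>F j in sequentially. \<not> ?B n \<subseteq> fst (s (r j)))"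
    using diagonal_subseq_eventually[of "\<lambda>n j. ?B n \<subseteq> fst (s j)"] by blast
  have "caratheodory_kernel q (s \<circ> r) = caratheodory_kernel q (s \<circ> r \<circ> t)"
    if t: "strict_mono t" for t
  proof -
    have sub: "\<forall>\<^sub>F j in sequentially. P (t j)" if "\<forall>\<^sub>F j in sequentially. P j" for P
      using eventually_subseq[OF t that] .
    have "(\<forall>\<^sub>F j in sequentially. ?B n \<subseteq> fst (s (r (t j)))) \<longleftrightarrow>
        (\<forall>\<^sub>F j in sequentially. ?B n \<subseteq> fst (s (r j)))" for n
    proof
      assume *: "\<forall>\<^sub>F j in sequentially. ?B n \<subseteq> fst (s (r (t j)))"
      \<comment> \<open>A further subsequence could gain basic sets that lie only in infinitely many
        domains. The dichotomy excludes this: eventual failure along \<open>r\<close> would persist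
        along \<open>t\<close> and contradict \<open>*\<close>.\<close>
      have "\<not> (\<forall>\<^sub>F j in sequentially. \<not> ?B n \<subseteq> fst (s (r j)))"
      proof
        assume "\<forall>\<^sub>F j in sequentially. \<not> ?B n \<subseteq> fst (s (r j))"
        from eventually_conj[OF * sub[OF this]] show False
          by simp
      qed
      then show "\<forall>\<^sub>F j in sequentially. ?B n \<subseteq> fst (s (r j))"
        using dich by blast
    qed (rule sub)
    then have "(\<Union>k. interior (\<Inter>j\<in>{k..}. fst ((s \<circ> r) j))) =
        (\<Union>k. interior (\<Inter>j\<in>{k..}. fst ((s \<circ> r \<circ> t) j)))"
      by (intro set_eqI) (simp only: mem_UN_interior_INT_iff[OF B] comp_apply)
    then show ?thesis
      by (simp only: caratheodory_kernel_eq)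
  qed
  then have "caratheodory_converges q (s \<circ> r)"
    unfolding caratheodory_converges_def using tamed_at_subseq[OF assms r] by blast
  with r show thesis by (rule that)
qed

theorem theorem3p2:
  fixes \<sigma> :: "nat \<Rightarrow> (complex ^ 'n) pointed" and q :: "complex ^ 'n"
  assumes "tamed_at q \<sigma>"
  shows "\<exists>r :: nat \<Rightarrow> nat. strict_mono r \<and> caratheodory_converges q (\<sigma> \<circ> r)"
  using caratheodory_converges_subseq[OF assms] by blast

end
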